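(* Let $F:\mathbb{Z}\to\mathbb{C}$ be a sequence satisfying a linear recurrence with constant coefficients of minimal order $D$, whose characteristic polynomial has the distinct nonzero roots $r_1,\dots,r_d$ with multiplicities $e_1,\dots,e_d$ (so $\sum_m e_m=D$), i.e. $F(n)=\sum_{m=1}^{d}\sum_{h=0}^{e_m-1}\lambda_{m,h}\,n^h r_m^n$ with $\lambda_{m,e_m-1}\neq 0$ for all $m$. Let $k\ge 1$ and let $a_i,b_i,c_i$ ($1\le i\le k$) be integers with $a_i\ge 0$, $a_i+b_i\ge 0$, and, for each $i$, $a_i$ and $a_i+b_i$ not both zero. For $n\ge 0$ let $$f(n)=\sum_{j=0}^{n-1}F(a_1n+b_1j+c_1)\cdots F(a_kn+b_kj+c_k).$$ Let $\Delta=\max_m(e_m-1)$, $\mu=|\{i: a_i=0\}|$ and $\beta=1+\Delta\mu$. Then there exist complex constants $\alpha_{i_1,\dots,i_k}$ and complex polynomials $\psi_{i_1,\dots,i_k}$ of degree at most $\beta$ (indexed by $0\le i_\nu\le D-1$, $1\le\nu\le k$) such that for all $n\ge 0$ $$f(n)=\sum_{i_1,\dots,i_k}\alpha_{i_1,\dots,i_k}\,F((a_1+b_1)n+i_1)\cdots F((a_k+b_k)n+i_k)+\sum_{i_1,\dots,i_k}\psi_{i_1,\dots,i_k}(n)\,F(a_1n+i_1)\cdots F(a_kn+i_k).$$ Moreover, if $F$ is rational-valued, such an expression exists in which all the constants $\alpha_{i_1,\dots,i_k}$ and all coefficients of the polynomials $\psi_{i_1,\dots,i_k}$ are rational.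
   Context: The displayed closed formula for $F$ defines $F(n)$ for all integers $n$ (equivalently, the recurrence is run backwards), so arguments of $F$ may be negative. *)

theory Defs
  imports Complex_Main "HOL-Library.FuncSet" "HOL-Computational_Algebra.Polynomial"
begin

definition satisfies_recurrence :: "(int \<Rightarrow> complex) \<Rightarrow> complex poly \<Rightarrow> bool" where
  "satisfies_recurrence F p \<longleftrightarrow>
     (\<forall>n. (\<Sum>i\<le>degree p. coeff p i * F (n + int i)) = 0)"

definition is_minimal_char_poly :: "(int \<Rightarrow> complex) \<Rightarrow> complex poly \<Rightarrow> bool" where
  "is_minimal_char_poly F p \<longleftrightarrow>
     lead_coeff p = 1 \<and> satisfies_recurrence F p \<and>
     (\<forall>q. lead_coeff q = 1 \<longrightarrow> satisfies_recurrence F q \<longrightarrow> degree p \<le> degree q)"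

definition product_sum ::
  "(int \<Rightarrow> complex) \<Rightarrow> nat \<Rightarrow> (nat \<Rightarrow> int) \<Rightarrow> (nat \<Rightarrow> int) \<Rightarrow> (nat \<Rightarrow> int) \<Rightarrow> nat \<Rightarrow> complex" where
  "product_sum F k a b c n =
     (\<Sum>j<n. \<Prod>\<nu>=1..k. F (a \<nu> * int n + b \<nu> * int j + c \<nu>))"

text \<open>The multi-indices are \<open>1..k\<close>-indexed families with values in \<open>0..D-1\<close>; they are made
  extensional so that each one is counted exactly once in the sums.\<close>

definition multi_indices :: "nat \<Rightarrow> nat \<Rightarrow> (nat \<Rightarrow> nat) set" where
  "multi_indices k D = ({1..k} \<rightarrow>\<^sub>E {..<D})"

definition is_closed_form ::
  "(int \<Rightarrow> complex) \<Rightarrow> nat \<Rightarrow> (nat \<Rightarrow> int) \<Rightarrow> (nat \<Rightarrow> int) \<Rightarrow> (nat \<Rightarrow> int) \<Rightarrow> nat \<Rightarrow> nat \<Rightarrow>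
    ((nat \<Rightarrow> nat) \<Rightarrow> complex) \<Rightarrow> ((nat \<Rightarrow> nat) \<Rightarrow> complex poly) \<Rightarrow> bool" where
  "is_closed_form F k a b c D \<beta> \<alpha> \<psi> \<longleftrightarrow>
     (\<forall>i\<in>multi_indices k D. degree (\<psi> i) \<le> \<beta>) \<and>
     (\<forall>n::nat. product_sum F k a b c n =
        (\<Sum>i\<in>multi_indices k D. \<alpha> i * (\<Prod>\<nu>=1..k. F ((a \<nu> + b \<nu>) * int n + int (i \<nu>)))) +
        (\<Sum>i\<in>multi_indices k D. poly (\<psi> i) (of_nat n) * (\<Prod>\<nu>=1..k. F (a \<nu> * int n + int (i \<nu>)))))"

end

theory Submission
  imports Defs "HOL-Library.Function_Algebras"
    "HOL-Computational_Algebra.Fundamental_Theorem_Algebra"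
begin

text \<open>
  The functions \<open>n \<mapsto> n\<^sup>h r\<^sub>m\<^sup>n\<close> with \<open>h < e\<^sub>m\<close> lie in the span of \<open>F(n), \<dots>, F(n + D - 1)\<close>, so it
  suffices to sum products of exponential monomials in \<open>a\<^sub>\<nu> n + b\<^sub>\<nu> j + c\<^sub>\<nu>\<close>. With \<open>t = n - j\<close> this
  argument is \<open>(a\<^sub>\<nu> + b\<^sub>\<nu>) j + a\<^sub>\<nu> t + c\<^sub>\<nu>\<close>, so the sum becomes a combination of convolutions
  \<open>\<Sum>\<^sub>j j\<^sup>y \<rho>\<^sup>j t\<^sup>z \<sigma>\<^sup>t\<close>, where \<open>\<rho>\<close> and \<open>\<sigma>\<close> are the products of the \<open>r\<^sub>m\<close> raised to the
  \<open>a\<^sub>\<nu> + b\<^sub>\<nu>\<close> and to the \<open>a\<^sub>\<nu>\<close>, and factors with \<open>a\<^sub>\<nu> + b\<^sub>\<nu> = 0\<close> (\<open>a\<^sub>\<nu> = 0\<close>) contribute nothing to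
  \<open>y\<close> (to \<open>z\<close>). If \<open>\<rho> \<noteq> \<sigma>\<close>, the convolution is \<open>P(n) \<rho>\<^sup>n + Q(n) \<sigma>\<^sup>n\<close> with \<open>deg P \<le> y\<close> and
  \<open>deg Q \<le> z\<close>, and no polynomial factors are needed. If \<open>\<rho> = \<sigma>\<close>, it is \<open>Q(n) \<sigma>\<^sup>n\<close> with
  \<open>deg Q \<le> y + z + 1\<close>; the excess over the degree that products of the \<open>F(a\<^sub>\<nu> n + i)\<close> can absorb
  is at most \<open>1 + \<Delta> \<mu>\<close>. For rational \<open>F\<close>, a \<open>\<rat>\<close>-linear projection of \<open>\<complex>\<close> onto \<open>\<rat>\<close> applied to all
  coefficients yields a rational solution.
\<close>

section \<open>Spaces of complex-valued functions\<close>

interpretation fun_space: vector_space "\<lambda>(c::complex) (f::'a \<Rightarrow> complex) x. c * f x"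
  by unfold_locales (auto simp: fun_eq_iff algebra_simps)

abbreviation fspan :: "('a \<Rightarrow> complex) set \<Rightarrow> ('a \<Rightarrow> complex) set" where
  "fspan \<equiv> fun_space.span"

lemma fspan_add: "f \<in> fspan S \<Longrightarrow> g \<in> fspan S \<Longrightarrow> (\<lambda>x. f x + g x) \<in> fspan S"
  using fun_space.span_add[of f S g] by (simp add: plus_fun_def)

lemma fspan_scale: "f \<in> fspan S \<Longrightarrow> (\<lambda>x. c * f x) \<in> fspan S"
  using fun_space.span_scale[of f S c] by simp

lemma fspan_zero: "(\<lambda>x. 0) \<in> fspan S"
  using fun_space.span_zero[of S] by (simp add: zero_fun_def)

lemma fspan_sum: "(\<And>i. i \<in> I \<Longrightarrow> f i \<in> fspan S) \<Longrightarrow> (\<lambda>x. \<Sum>i\<in>I. f i x) \<in> fspan S"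
  by (induction I rule: infinite_finite_induct) (auto intro: fspan_add fspan_zero)

lemma fspan_induct [consumes 1, case_names zero step]:
  assumes "f \<in> fspan S"
    and "P (\<lambda>x. 0)"
    and "\<And>c s g. s \<in> S \<Longrightarrow> P g \<Longrightarrow> P (\<lambda>x. c * s x + g x)"
  shows "P f"
  using assms(1)
proof (induction rule: fun_space.span_induct_alt)
  case base
  then show ?case using assms(2) by (simp add: zero_fun_def)
next
  case (step c x y)
  then show ?case using assms(3)[of x y c] by (simp add: plus_fun_def)
qed

lemma fspan_mono: "f \<in> fspan S \<Longrightarrow> S \<subseteq> T \<Longrightarrow> f \<in> fspan T"
  using fun_space.span_mono by blast

lemma fspan_trans: "f \<in> fspan S \<Longrightarrow> (\<And>s. s \<in> S \<Longrightarrow> s \<in> fspan T) \<Longrightarrow> f \<in> fspan T"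
  by (induction rule: fspan_induct) (auto intro!: fspan_add fspan_zero fspan_scale)

text \<open>Membership propagates through a linear operator \<open>L\<close>, checked on the
  generators only. \<open>L\<close> may change the domain: it is used for restriction to a
  progression, for multiplication by a fixed function, and for summation over
  \<open>j\<close>.\<close>

lemma fspan_linear_image:
  assumes "f \<in> fspan S"
    and "L (\<lambda>x. 0) = (\<lambda>y. 0)"
    and "\<And>c g h. L (\<lambda>x. c * g x + h x) = (\<lambda>y. c * L g y + L h y)"
    and "\<And>s. s \<in> S \<Longrightarrow> L s \<in> fspan T"
  shows "L f \<in> fspan T"
  using assms(1)
  by (induction rule: fspan_induct)
    (auto simp: assms(2,3) intro!: fspan_add fspan_zero fspan_scale assms(4))

lemma fspan_mult:
  assumes "f \<in> fspan S" "g \<in> fspan T"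
    and "\<And>s t. s \<in> S \<Longrightarrow> t \<in> T \<Longrightarrow> (\<lambda>x. s x * t x) \<in> fspan U"
  shows "(\<lambda>x. f x * g x) \<in> fspan U"
proof (rule fspan_linear_image[OF assms(1), where L = "\<lambda>f x. f x * g x"])
  fix s assume "s \<in> S"
  then show "(\<lambda>x. s x * g x) \<in> fspan U"
    using assms(3)
    by (intro fspan_linear_image[OF assms(2), where L = "\<lambda>g x. s x * g x"])
      (auto simp: distrib_left mult.left_commute)
qed (auto simp: algebra_simps)

text \<open>Coefficients are indexed by \<open>I\<close> and not by the functions themselves, so
  \<open>v\<close> may fail to be injective: different multi-indices can give the same
  product.\<close>

lemma fspan_imageE:
  assumes "f \<in> fspan (v ` I)" "finite I"
  obtains u where "f = (\<lambda>x. \<Sum>i\<in>I. u i * v i x)"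
proof -
  from assms(1) have "\<exists>u. f = (\<lambda>x. \<Sum>i\<in>I. u i * v i x)"
  proof (induction rule: fspan_induct)
    case zero
    show ?case by (rule exI[of _ "\<lambda>_. 0"]) simp
  next
    case (step c s g)
    then obtain i u where i: "i \<in> I" "s = v i" and u: "g = (\<lambda>x. \<Sum>i\<in>I. u i * v i x)"
      by auto
    have "(\<Sum>j\<in>I. (u j + (if j = i then c else 0)) * v j x) = c * s x + g x" for x
    proof -
      have "(\<Sum>j\<in>I. (u j + (if j = i then c else 0)) * v j x) =
          (\<Sum>j\<in>I. u j * v j x + (if j = i then c * v j x else 0))"
        by (rule sum.cong) (auto simp: algebra_simps)
      then show ?thesis
        using i u assms(2) by (simp add: sum.distrib)
    qed
    then show ?case by (intro exI[of _ "\<lambda>j. u j + (if j = i then c else 0)"]) auto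
  qed
  then show ?thesis using that by blast
qed

lemma fspan_imageI: "(\<lambda>x. \<Sum>i\<in>I. u i * v i x) \<in> fspan (v ` I)"
  by (intro fspan_sum fspan_scale fun_space.span_base imageI)

text \<open>Expanding a product of sums picks one generator per factor; the choice functions in
  \<open>PiE I A\<close> become the multi-indices.\<close>

lemma fspan_prod_PiE:
  assumes "finite I" "\<And>\<nu>. \<nu> \<in> I \<Longrightarrow> finite (A \<nu>)"
    and "\<And>\<nu>. \<nu> \<in> I \<Longrightarrow> g \<nu> \<in> fspan (v \<nu> ` A \<nu>)"
  shows "(\<lambda>x. \<Prod>\<nu>\<in>I. g \<nu> x) \<in> fspan ((\<lambda>i x. \<Prod>\<nu>\<in>I. v \<nu> (i \<nu>) x) ` PiE I A)"
proof -
  have "\<forall>\<nu>\<in>I. \<exists>u. g \<nu> = (\<lambda>x. \<Sum>i\<in>A \<nu>. u i * v \<nu> i x)"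
    using fspan_imageE[OF assms(3) assms(2)] by metis
  then obtain u where u: "\<forall>\<nu>\<in>I. g \<nu> = (\<lambda>x. \<Sum>i\<in>A \<nu>. u \<nu> i * v \<nu> i x)"
    by metis
  have "(\<lambda>x. \<Prod>\<nu>\<in>I. g \<nu> x) = (\<lambda>x. \<Prod>\<nu>\<in>I. \<Sum>i\<in>A \<nu>. u \<nu> i * v \<nu> i x)"
    using u by (intro ext prod.cong) (auto dest: fun_cong)
  also have "\<dots> = (\<lambda>x. \<Sum>i\<in>PiE I A. (\<Prod>\<nu>\<in>I. u \<nu> (i \<nu>)) * (\<Prod>\<nu>\<in>I. v \<nu> (i \<nu>) x))"
    using assms(1,2) by (simp add: prod_sum_PiE prod.distrib)
  finally show ?thesis
    using fspan_imageI[of "\<lambda>i. \<Prod>\<nu>\<in>I. u \<nu> (i \<nu>)" "\<lambda>i x. \<Prod>\<nu>\<in>I. v \<nu> (i \<nu>) x" "PiE I A"] by simp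
qed

section \<open>Shifts of a recurrent sequence\<close>

text \<open>A nontrivial relation among the shifts, scaled to be monic, would be a recurrence for
  \<open>F\<close> of degree below \<open>degree p\<close>, against minimality.\<close>

lemma minimal_shifts_independent:
  assumes "is_minimal_char_poly F p"
    and zero: "\<And>n. (\<Sum>i<degree p. c i * F (n + int i)) = 0"
    and "i < degree p"
  shows "c i = 0"
proof (rule ccontr)
  assume ci: "c i \<noteq> 0"
  define q where "q = (\<Sum>i<degree p. monom (c i) i)"
  have cq: "coeff q j = (if j < degree p then c j else 0)" for j
    by (simp add: q_def coeff_sum)
  have "q \<noteq> 0" using ci cq[of i] assms(3) by auto
  then have dq: "degree q < degree p"
    by (metis cq leading_coeff_0_iff)
  define q' where "q' = smult (inverse (lead_coeff q)) q"
  have dq': "degree q' = degree q" and lq': "lead_coeff q' = 1"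
    using \<open>q \<noteq> 0\<close> by (auto simp: q'_def)
  have "(\<Sum>i\<le>degree q'. coeff q' i * F (n + int i)) = 0" for n
  proof -
    have "(\<Sum>i\<le>degree q. coeff q i * F (n + int i)) = (\<Sum>i<degree p. c i * F (n + int i))"
      using dq by (intro sum.mono_neutral_cong_left) (auto simp: cq coeff_eq_0 not_le, metis cq coeff_eq_0)
    then show ?thesis
      by (simp add: dq' zero q'_def mult.assoc flip: sum_distrib_left del: inverse_eq_divide)
  qed
  then have "satisfies_recurrence F q'"
    by (simp add: satisfies_recurrence_def)
  then have "degree p \<le> degree q'"
    using assms(1) lq' by (auto simp: is_minimal_char_poly_def)
  then show False using dq dq' by simp
qed

definition exp_monomial :: "complex \<Rightarrow> nat \<Rightarrow> int \<Rightarrow> complex" where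
  "exp_monomial z h n = of_int n ^ h * z powi n"

text \<open>Binomial theorem for \<open>(n + s) ^ h\<close>; since \<open>z\<close> is nonzero,
  \<open>z powi (n + s)\<close> splits for integers of any sign.\<close>

lemma exp_monomial_shift:
  assumes "z \<noteq> 0"
  shows "(\<lambda>n. exp_monomial z h (n + s)) \<in> fspan (exp_monomial z ` {..h})"
proof -
  have "(\<lambda>n. exp_monomial z h (n + s)) =
      (\<lambda>n. \<Sum>i\<le>h. (of_nat (h choose i) * of_int s ^ (h - i) * z powi s) * exp_monomial z i n)"
    using assms
    by (auto simp: exp_monomial_def fun_eq_iff binomial_ring sum_distrib_right sum_distrib_left
        power_int_add intro!: sum.cong)
  then show ?thesis by (simp only:) (rule fspan_imageI)
qed

lemma degree_eq_sum_order:
  fixes p :: "complex poly"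
  assumes "p \<noteq> 0"
  shows "degree p = (\<Sum>z | poly p z = 0. order z p)"
proof -
  have "degree p = degree (\<Prod>z | poly p z = 0. [:-z, 1:] ^ order z p)"
    using assms by (subst complex_poly_decompose[symmetric]) (simp add: degree_smult_eq)
  also have "\<dots> = (\<Sum>z | poly p z = 0. degree ([:-z, 1:] ^ order z p))"
    by (rule degree_prod_eq_sum_degree) auto
  finally show ?thesis by (simp add: degree_linear_power)
qed

text \<open>By minimality the \<open>D\<close> shifts of \<open>F\<close> are independent, and they lie in the span of the \<open>D\<close>
  functions \<open>n\<^sup>h r\<^sub>m\<^sup>n\<close>; so the two families span the same space.\<close>

lemma exp_monomial_in_span_shifts:
  fixes r :: "nat \<Rightarrow> complex"
  assumes minimal: "is_minimal_char_poly F p"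
    and inj: "inj_on r {1..d}"
    and roots: "{z. poly p z = 0} = r ` {1..d}"
    and nz: "\<And>m. m \<in> {1..d} \<Longrightarrow> r m \<noteq> 0"
    and e: "\<And>m. m \<in> {1..d} \<Longrightarrow> e m = order (r m) p"
    and F: "\<And>n. F n = (\<Sum>m=1..d. \<Sum>h<e m. lam m h * of_int n ^ h * r m powi n)"
    and m: "m \<in> {1..d}" "h < e m"
  shows "exp_monomial (r m) h \<in> fspan ((\<lambda>i n. F (n + int i)) ` {..<degree p})"
proof -
  define I where "I = (SIGMA m:{1..d}. {..<e m})"
  define T where "T = (\<lambda>(m, h). exp_monomial (r m) h) ` I"
  define B where "B = (\<lambda>i n. F (n + int i)) ` {..<degree p}"
  have "p \<noteq> 0" using minimal by (auto simp: is_minimal_char_poly_def)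
  have "finite I" by (simp add: I_def)
  then have "finite T" by (simp add: T_def)
  \<comment> \<open>Over the complex numbers the root multiplicities add up to the degree, so there
    are at most \<open>degree p\<close> exponential monomials.\<close>
  have "card T \<le> card I" unfolding T_def by (rule card_image_le) fact
  also have "card I = (\<Sum>m=1..d. e m)" by (simp add: I_def)
  also have "\<dots> = (\<Sum>m=1..d. order (r m) p)" using e by (intro sum.cong) auto
  also have "\<dots> = degree p"
    using degree_eq_sum_order[OF \<open>p \<noteq> 0\<close>] sum.reindex[OF inj, of "\<lambda>z. order z p"] by (simp add: roots)
  finally have "card T \<le> degree p" .
  have shift: "(\<lambda>n. F (n + int i)) \<in> fspan T" for i
  proof -
    have "(\<lambda>n. exp_monomial (r m) h (n + int i)) \<in> fspan T" if "m \<in> {1..d}" "h < e m" for m h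
      by (rule fspan_mono[OF exp_monomial_shift]) (use that nz in \<open>auto simp: T_def I_def image_iff\<close>)
    then have "(\<lambda>n. \<Sum>m=1..d. \<Sum>h<e m. lam m h * exp_monomial (r m) h (n + int i)) \<in> fspan T"
      by (intro fspan_sum fspan_scale) auto
    then show ?thesis by (simp add: F[abs_def] exp_monomial_def mult.assoc)
  qed
  have injB: "inj_on (\<lambda>i n. F (n + int i)) {..<degree p}"
  proof (rule inj_onI, rule ccontr)
    fix i j assume ij: "i \<in> {..<degree p}" "j \<in> {..<degree p}"
      "(\<lambda>n. F (n + int i)) = (\<lambda>n. F (n + int j))" "i \<noteq> j"
    \<comment> \<open>Two equal shifts give a relation with coefficient 1 at \<open>i\<close> and -1
      at \<open>j\<close>; independence forces its coefficient at \<open>i\<close> to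
      vanish.\<close>
    have "(if i = i then 1 else if i = j then -1 else 0) = (0::complex)"
    proof (rule minimal_shifts_independent[OF minimal,
          where c = "\<lambda>l. if l = i then 1 else if l = j then -1 else 0"])
      fix n
      have "(\<Sum>l<degree p. (if l = i then 1 else if l = j then -1 else 0) * F (n + int l)) =
          (\<Sum>l<degree p. (if l = i then F (n + int l) else 0) - (if l = j then F (n + int l) else 0))"
        using ij(4) by (intro sum.cong) auto
      also have "\<dots> = F (n + int i) - F (n + int j)" using ij by (simp add: sum_subtractf)
      finally show "(\<Sum>l<degree p. (if l = i then 1 else if l = j then -1 else 0) * F (n + int l)) = 0"
        using ij(3) by (auto dest: fun_cong[of _ _ n])
    qed (use ij in auto)
    then show False by simp
  qed
  then have cardB: "card B = degree p" by (simp add: B_def card_image)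
  have indepB: "fun_space.independent B"
  proof (rule fun_space.independent_if_scalars_zero)
    fix c f assume zero: "(\<Sum>x\<in>B. (\<lambda>y. c x * x y)) = 0" and "f \<in> B"
    then obtain i where i: "i < degree p" "f = (\<lambda>n. F (n + int i))" by (auto simp: B_def)
    have s: "(\<Sum>x\<in>X. (\<lambda>y. c x * x y)) n = (\<Sum>x\<in>X. c x * x n)" for X and n :: int
      by (induction X rule: infinite_finite_induct) auto
    have "(\<Sum>x\<in>B. c x * x n) = 0" for n using zero s[of B n] by simp
    then have "(\<Sum>i<degree p. c (\<lambda>n. F (n + int i)) * F (n + int i)) = 0" for n
      by (simp add: B_def sum.reindex[OF injB])
    from minimal_shifts_independent[OF minimal this i(1)] show "c f = 0" by (simp add: i(2))
  qed (simp add: B_def)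
  show ?thesis
  proof (rule ccontr)
    let ?x = "exp_monomial (r m) h"
    assume "\<not> ?thesis"
    then have x: "?x \<notin> fspan B" by (simp add: B_def)
    \<comment> \<open>Dimension count: these would be \<open>degree p + 1\<close> independent
      functions in the span of the at most \<open>degree p\<close> elements of
      \<open>T\<close>.\<close>
    then have "fun_space.independent (insert ?x B)"
      using indepB by (rule fun_space.independent_insertI)
    moreover have "?x \<in> T" using m by (force simp: T_def I_def)
    then have "insert ?x B \<subseteq> fspan T"
      using shift by (auto simp: B_def intro: fun_space.span_base)
    ultimately have "card (insert ?x B) \<le> card T"
      using fun_space.independent_span_bound[OF \<open>finite T\<close>] by blast
    moreover have "?x \<notin> B" using x fun_space.span_base by blast
    ultimately show False
      using cardB \<open>card T \<le> degree p\<close> by (simp add: B_def)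
  qed
qed

section \<open>Convolutions of exponential monomials\<close>

definition nat_monomial :: "complex \<Rightarrow> nat \<Rightarrow> nat \<Rightarrow> complex" where
  "nat_monomial \<rho> l n = of_nat n ^ l * \<rho> ^ n"

text \<open>The top power is split off because the lower ones are what the inductions on the
  exponent absorb.\<close>

lemma power_Suc_expand:
  "(of_nat (Suc n) :: complex) ^ l =
    of_nat n ^ l + (\<Sum>i<l. of_nat (l choose i) * of_nat n ^ i)"
proof -
  have "(of_nat (Suc n) :: complex) ^ l = (\<Sum>i\<le>l. of_nat (l choose i) * of_nat n ^ i)"
    using binomial_ring[of "of_nat n :: complex" 1 l] by (simp add: add.commute)
  also have "{..l} = insert l {..<l}" by auto
  finally show ?thesis by simp
qed

text \<open>The operator taking \<open>h n\<close> to \<open>h (Suc n) - \<sigma> * h n\<close>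
  sends \<open>n ^ l * \<rho> ^ n\<close> to \<open>\<rho> - \<sigma>\<close> times itself plus
  terms with lower powers of \<open>n\<close>. The factor is invertible, and the lower terms are
  cancelled by the solutions for smaller exponents.\<close>

lemma solve_recurrence_nonresonant:
  assumes "\<rho> \<noteq> \<sigma>"
  shows "\<exists>h\<in>fspan (nat_monomial \<rho> ` {..l}). \<forall>n. h (Suc n) = \<sigma> * h n + nat_monomial \<rho> l n"
proof (induction l rule: less_induct)
  case (less l)
  have "\<exists>h. h \<in> fspan (nat_monomial \<rho> ` {..l}) \<and>
      (\<forall>n. h (Suc n) = \<sigma> * h n + nat_monomial \<rho> i n)" if "i < l" for i
  proof -
    have "nat_monomial \<rho> ` {..i} \<subseteq> nat_monomial \<rho> ` {..l}" using that by auto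
    then show ?thesis using less[OF that] fspan_mono by blast
  qed
  then obtain h where h: "\<And>i. i < l \<Longrightarrow> h i \<in> fspan (nat_monomial \<rho> ` {..l})"
    and h_Suc: "\<And>i n. i < l \<Longrightarrow> h i (Suc n) = \<sigma> * h i n + nat_monomial \<rho> i n"
    by metis
  define g where "g = (\<lambda>n. inverse (\<rho> - \<sigma>) *
    (nat_monomial \<rho> l n + (- \<rho>) * (\<Sum>i<l. of_nat (l choose i) * h i n)))"
  have "g \<in> fspan (nat_monomial \<rho> ` {..l})"
    unfolding g_def
    by (intro fspan_scale fspan_add fspan_sum h fun_space.span_base) auto
  moreover have "g (Suc n) = \<sigma> * g n + nat_monomial \<rho> l n" for n
  proof -
    let ?A = "\<Sum>i<l. of_nat (l choose i) * h i n"
    let ?B = "\<Sum>i<l. of_nat (l choose i) * nat_monomial \<rho> i n"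
    have *: "(\<Sum>i<l. of_nat (l choose i) * h i (Suc n)) = \<sigma> * ?A + ?B"
      by (simp add: h_Suc algebra_simps sum.distrib sum_distrib_left)
    have **: "nat_monomial \<rho> l (Suc n) = \<rho> * nat_monomial \<rho> l n + \<rho> * ?B"
      unfolding nat_monomial_def power_Suc_expand
      by (simp add: algebra_simps sum_distrib_left)
    show ?thesis
      using assms unfolding g_def * ** by (simp add: divide_simps) (simp add: algebra_simps)
  qed
  ultimately show ?case by blast
qed

text \<open>When the bases agree, the leading term cancels, so the ansatz starts one power higher:
  \<open>n ^ (l + 1) * \<sigma> ^ n\<close> is sent to
  \<open>\<sigma> * (l + 1) * n ^ l * \<sigma> ^ n\<close> plus lower terms. This is the source of
  every gain of one degree below.\<close>

lemma solve_recurrence_resonant: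
  assumes "\<sigma> \<noteq> 0"
  shows "\<exists>h\<in>fspan (nat_monomial \<sigma> ` {..Suc l}). \<forall>n. h (Suc n) = \<sigma> * h n + nat_monomial \<sigma> l n"
proof (induction l rule: less_induct)
  case (less l)
  have "\<exists>h. h \<in> fspan (nat_monomial \<sigma> ` {..Suc l}) \<and>
      (\<forall>n. h (Suc n) = \<sigma> * h n + nat_monomial \<sigma> i n)" if "i < l" for i
  proof -
    have "nat_monomial \<sigma> ` {..Suc i} \<subseteq> nat_monomial \<sigma> ` {..Suc l}" using that by auto
    then show ?thesis using less[OF that] fspan_mono by blast
  qed
  then obtain h where h: "\<And>i. i < l \<Longrightarrow> h i \<in> fspan (nat_monomial \<sigma> ` {..Suc l})"
    and h_Suc: "\<And>i n. i < l \<Longrightarrow> h i (Suc n) = \<sigma> * h i n + nat_monomial \<sigma> i n"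
    by metis
  define g where "g = (\<lambda>n. inverse (\<sigma> * of_nat (Suc l)) *
    (nat_monomial \<sigma> (Suc l) n + (- \<sigma>) * (\<Sum>i<l. of_nat (Suc l choose i) * h i n)))"
  have "g \<in> fspan (nat_monomial \<sigma> ` {..Suc l})"
    unfolding g_def
    by (intro fspan_scale fspan_add fspan_sum h fun_space.span_base) auto
  moreover have "g (Suc n) = \<sigma> * g n + nat_monomial \<sigma> l n" for n
  proof -
    let ?A = "\<Sum>i<l. of_nat (Suc l choose i) * h i n"
    let ?B = "\<Sum>i<l. of_nat (Suc l choose i) * nat_monomial \<sigma> i n"
    have *: "(\<Sum>i<l. of_nat (Suc l choose i) * h i (Suc n)) = \<sigma> * ?A + ?B"
      by (simp add: h_Suc algebra_simps sum.distrib sum_distrib_left del: binomial_Suc_Suc)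
    have **: "nat_monomial \<sigma> (Suc l) (Suc n) =
        \<sigma> * nat_monomial \<sigma> (Suc l) n + \<sigma> * ?B + \<sigma> * of_nat (Suc l) * nat_monomial \<sigma> l n"
      unfolding nat_monomial_def power_Suc_expand
      unfolding power_Suc[of \<sigma>]
      by (simp add: algebra_simps sum_distrib_left del: power_Suc of_nat_Suc)
    \<comment> \<open>Here \<open>c\<close> stands for \<open>\<sigma> * of_nat (Suc l)\<close>; the
      lower-order contributions \<open>\<sigma> * B\<close> cancel.\<close>
    have "inverse c * (\<sigma> * M + \<sigma> * B + c * m + (- \<sigma>) * (\<sigma> * A + B)) =
        \<sigma> * (inverse c * (M + (- \<sigma>) * A)) + m" if "c \<noteq> 0" for c M B m A
      using that by (simp add: divide_simps) (simp add: algebra_simps)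
    moreover have "\<sigma> * of_nat (Suc l) \<noteq> 0"
      using assms of_nat_neq_0 by simp
    ultimately show ?thesis unfolding g_def * ** by blast
  qed
  ultimately show ?case by blast
qed

text \<open>Superposition gives a particular solution \<open>h\<close> in the span. \<open>S\<close>
  differs from it by a solution of the homogeneous recurrence, and \<open>S 0 = 0\<close> fixes that
  to be \<open>- h 0\<close> times \<open>\<sigma> ^ n\<close>.\<close>

lemma recurrence_solution_in_fspan:
  assumes "g \<in> fspan G"
    and basis: "\<And>g. g \<in> G \<Longrightarrow> \<exists>h\<in>fspan T. \<forall>n. h (Suc n) = \<sigma> * h n + g n"
    and S: "S 0 = 0" "\<And>n. S (Suc n) = \<sigma> * S n + g n"
    and hom: "nat_monomial \<sigma> 0 \<in> fspan T"
  shows "S \<in> fspan T"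
proof -
  from assms(1) have "\<exists>h\<in>fspan T. \<forall>n. h (Suc n) = \<sigma> * h n + g n"
  proof (induction rule: fspan_induct)
    case zero
    show ?case by (rule bexI[of _ "\<lambda>_. 0"]) (auto simp: fspan_zero)
  next
    case (step c s g)
    then obtain h where h: "h \<in> fspan T" "\<And>n. h (Suc n) = \<sigma> * h n + g n" by blast
    from basis[OF step(1)] obtain h' where
      h': "h' \<in> fspan T" "\<And>n. h' (Suc n) = \<sigma> * h' n + s n" by blast
    show ?case
      by (rule bexI[of _ "\<lambda>n. c * h' n + h n"])
        (auto simp: h h' algebra_simps intro!: fspan_add fspan_scale h(1) h'(1))
  qed
  then obtain h where h: "h \<in> fspan T" "\<And>n. h (Suc n) = \<sigma> * h n + g n" by blast
  have "S n = h n + (- h 0) * nat_monomial \<sigma> 0 n" for n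
    by (induction n) (simp_all add: S h(2) nat_monomial_def right_diff_distrib)
  then have "S = (\<lambda>n. h n + (- h 0) * nat_monomial \<sigma> 0 n)" by auto
  then show ?thesis using fspan_add[OF h(1) fspan_scale[OF hom, of "- h 0"]] by metis
qed

definition convolution :: "complex \<Rightarrow> complex \<Rightarrow> nat \<Rightarrow> nat \<Rightarrow> nat \<Rightarrow> complex" where
  "convolution \<rho> \<sigma> y z n = (\<Sum>j<n. nat_monomial \<rho> y j * nat_monomial \<sigma> z (n - j))"

text \<open>As a function of \<open>n\<close> the convolution solves a first-order recurrence whose
  inhomogeneity involves only smaller \<open>z\<close>: expand the power of
  \<open>(n - j) + 1\<close> binomially. The new summand \<open>j = n\<close> has
  \<open>n - j\<close> replaced by 1 and so contributes just
  \<open>\<sigma> * nat_monomial \<rho> y n\<close>.\<close>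

lemma convolution_Suc:
  "convolution \<rho> \<sigma> y z (Suc n) = \<sigma> * convolution \<rho> \<sigma> y z n +
    \<sigma> * ((\<Sum>i<z. of_nat (z choose i) * convolution \<rho> \<sigma> y i n) + nat_monomial \<rho> y n)"
proof -
  have *: "nat_monomial \<sigma> z (Suc m) = \<sigma> * nat_monomial \<sigma> z m +
      \<sigma> * (\<Sum>i<z. of_nat (z choose i) * nat_monomial \<sigma> i m)" for m
    unfolding nat_monomial_def power_Suc_expand by (simp add: algebra_simps sum_distrib_left)
  have "convolution \<rho> \<sigma> y z (Suc n) =
      (\<Sum>j<n. nat_monomial \<rho> y j * nat_monomial \<sigma> z (Suc (n - j))) + \<sigma> * nat_monomial \<rho> y n"
    by (simp add: convolution_def Suc_diff_le nat_monomial_def)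
  also have "(\<Sum>j<n. nat_monomial \<rho> y j * nat_monomial \<sigma> z (Suc (n - j))) =
      \<sigma> * convolution \<rho> \<sigma> y z n +
      \<sigma> * (\<Sum>j<n. \<Sum>i<z. of_nat (z choose i) * (nat_monomial \<rho> y j * nat_monomial \<sigma> i (n - j)))"
    unfolding * convolution_def
    by (simp add: algebra_simps sum.distrib sum_distrib_left)
  also have "(\<Sum>j<n. \<Sum>i<z. of_nat (z choose i) * (nat_monomial \<rho> y j * nat_monomial \<sigma> i (n - j))) =
      (\<Sum>i<z. of_nat (z choose i) * convolution \<rho> \<sigma> y i n)"
    unfolding convolution_def by (subst sum.swap) (simp add: sum_distrib_left)
  finally show ?thesis by (simp add: algebra_simps)
qed

text \<open>By induction the inhomogeneity has \<open>\<rho>\<close>-degree at most \<open>y\<close>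
  and \<open>\<sigma>\<close>-degree below \<open>z\<close>. Solving keeps the former and raises the
  latter by at most one.\<close>

lemma convolution_nonresonant:
  assumes "\<rho> \<noteq> \<sigma>" "\<sigma> \<noteq> 0"
  shows "convolution \<rho> \<sigma> y z \<in> fspan (nat_monomial \<rho> ` {..y} \<union> nat_monomial \<sigma> ` {..z})"
proof (induction z rule: less_induct)
  case (less z)
  let ?G = "nat_monomial \<rho> ` {..y} \<union> nat_monomial \<sigma> ` {..<z}"
  let ?T = "nat_monomial \<rho> ` {..y} \<union> nat_monomial \<sigma> ` {..z}"
  show ?case
  proof (rule recurrence_solution_in_fspan[where G = ?G])
    have "convolution \<rho> \<sigma> y i \<in> fspan ?G" if "i < z" for i
      by (rule fspan_mono[OF less[OF that]]) (use that in auto)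
    then show "(\<lambda>n. \<sigma> * ((\<Sum>i<z. of_nat (z choose i) * convolution \<rho> \<sigma> y i n)
        + nat_monomial \<rho> y n)) \<in> fspan ?G"
      by (intro fspan_scale fspan_add fspan_sum) (auto intro: fun_space.span_base)
  next
    fix g assume "g \<in> ?G"
    then consider l where "l \<le> y" "g = nat_monomial \<rho> l" | l where "l < z" "g = nat_monomial \<sigma> l"
      by auto
    then show "\<exists>h\<in>fspan ?T. \<forall>n. h (Suc n) = \<sigma> * h n + g n"
    proof cases
      case 1
      have "nat_monomial \<rho> ` {..l} \<subseteq> ?T" using 1 by auto
      then show ?thesis
        using solve_recurrence_nonresonant[OF assms(1), of l] 1 fspan_mono by metis
    next
      case 2
      have "nat_monomial \<sigma> ` {..Suc l} \<subseteq> ?T" using 2 by auto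
      then show ?thesis
        using solve_recurrence_resonant[OF assms(2), of l] 2 fspan_mono by metis
    qed
  qed (auto simp: convolution_Suc convolution_def[of _ _ _ _ 0] intro: fun_space.span_base)
qed

text \<open>The inhomogeneity has degree at most \<open>y + z\<close>, all of it resonant, so
  solving raises the degree by at most one.\<close>

lemma convolution_resonant:
  assumes "\<sigma> \<noteq> 0"
  shows "convolution \<sigma> \<sigma> y z \<in> fspan (nat_monomial \<sigma> ` {..Suc (y + z)})"
proof (induction z rule: less_induct)
  case (less z)
  let ?G = "nat_monomial \<sigma> ` {..y + z}"
  show ?case
  proof (rule recurrence_solution_in_fspan[where G = ?G])
    have "convolution \<sigma> \<sigma> y i \<in> fspan ?G" if "i < z" for i
      by (rule fspan_mono[OF less[OF that]]) (use that in auto)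
    then show "(\<lambda>n. \<sigma> * ((\<Sum>i<z. of_nat (z choose i) * convolution \<sigma> \<sigma> y i n)
        + nat_monomial \<sigma> y n)) \<in> fspan ?G"
      by (intro fspan_scale fspan_add fspan_sum) (auto intro: fun_space.span_base)
  next
    fix g assume "g \<in> ?G"
    then obtain l where l: "l \<le> y + z" "g = nat_monomial \<sigma> l" by auto
    then have "nat_monomial \<sigma> ` {..Suc l} \<subseteq> nat_monomial \<sigma> ` {..Suc (y + z)}" by auto
    then show "\<exists>h\<in>fspan (nat_monomial \<sigma> ` {..Suc (y + z)}). \<forall>n. h (Suc n) = \<sigma> * h n + g n"
      using solve_recurrence_resonant[OF assms, of l] l fspan_mono by metis
  qed (auto simp: convolution_Suc convolution_def[of _ _ _ _ 0] intro: fun_space.span_base)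
qed

text \<open>Polynomials in \<open>j\<close> and \<open>t\<close> with a bound on each partial degree
  and on the total degree. The partial bounds serve the case
  \<open>\<rho> \<noteq> \<sigma>\<close>, the total one the case
  \<open>\<rho> = \<sigma>\<close>.\<close>

definition bispan :: "nat \<Rightarrow> nat \<Rightarrow> nat \<Rightarrow> (nat \<times> nat \<Rightarrow> complex) set" where
  "bispan A B H = fspan ((\<lambda>(y, z) (j, t). of_nat j ^ y * of_nat t ^ z) `
     {(y, z). y \<le> A \<and> z \<le> B \<and> y + z \<le> H})"

lemma bispan_monomial:
  "y \<le> A \<Longrightarrow> z \<le> B \<Longrightarrow> y + z \<le> H \<Longrightarrow>
    (\<lambda>(j, t). of_nat j ^ y * of_nat t ^ z) \<in> bispan A B H"
  unfolding bispan_def by (intro fun_space.span_base) force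

lemma bispan_mult:
  assumes "f \<in> bispan A B H" "g \<in> bispan A' B' H'"
  shows "(\<lambda>x. f x * g x) \<in> bispan (A + A') (B + B') (H + H')"
  unfolding bispan_def
proof (rule fspan_mult[OF assms[unfolded bispan_def]])
  let ?m = "\<lambda>(y, z) (j, t). of_nat j ^ y * of_nat t ^ z :: complex"
  fix s t
  assume "s \<in> ?m ` {(y, z). y \<le> A \<and> z \<le> B \<and> y + z \<le> H}"
    and "t \<in> ?m ` {(y, z). y \<le> A' \<and> z \<le> B' \<and> y + z \<le> H'}"
  then obtain y z y' z' where s: "s = ?m (y, z)" "y \<le> A" "z \<le> B" "y + z \<le> H"
    and t: "t = ?m (y', z')" "y' \<le> A'" "z' \<le> B'" "y' + z' \<le> H'" by blast
  have eq: "(\<lambda>x. s x * t x) = ?m (y + y', z + z')"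
    by (simp add: s(1) t(1) fun_eq_iff power_add)
  have mem: "(y + y', z + z') \<in> {(y, z). y \<le> A + A' \<and> z \<le> B + B' \<and> y + z \<le> H + H'}"
    using s t by simp
  show "(\<lambda>x. s x * t x) \<in> fspan (?m `
      {(y, z). y \<le> A + A' \<and> z \<le> B + B' \<and> y + z \<le> H + H'})"
    unfolding eq by (intro fun_space.span_base imageI mem)
qed

lemma bispan_power:
  assumes "f \<in> bispan A B H"
  shows "(\<lambda>x. f x ^ h) \<in> bispan (h * A) (h * B) (h * H)"
proof (induction h)
  case 0
  show ?case using bispan_monomial[of 0 0 0 0 0] by (simp add: case_prod_unfold)
next
  case (Suc h)
  then show ?case using bispan_mult[OF assms Suc] by simp
qed

lemma bispan_prod:
  assumes "finite I" "\<And>\<nu>. \<nu> \<in> I \<Longrightarrow> f \<nu> \<in> bispan (A \<nu>) (B \<nu>) (H \<nu>)"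
  shows "(\<lambda>x. \<Prod>\<nu>\<in>I. f \<nu> x) \<in> bispan (sum A I) (sum B I) (sum H I)"
  using assms
proof (induction I)
  case empty
  show ?case using bispan_monomial[of 0 0 0 0 0] by (simp add: case_prod_unfold)
next
  case (insert \<nu> I)
  then show ?case by (simp add: bispan_mult)
qed

text \<open>The case distinctions record that a vanishing coefficient costs no degree in its
  variable; this is how factors with \<open>a \<nu> = 0\<close> or
  \<open>a \<nu> + b \<nu> = 0\<close> enter the degree count.\<close>

lemma bispan_linear_form:
  "(\<lambda>(j, t). u * of_nat j + v * of_nat t + w)
    \<in> bispan (if u = 0 then 0 else 1) (if v = 0 then 0 else 1) 1"
proof -
  let ?S = "bispan (if u = 0 then 0 else 1) (if v = 0 then 0 else 1) 1"
  have u: "(\<lambda>(j, t). u * of_nat j) \<in> ?S"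
  proof (cases "u = 0")
    case True
    then show ?thesis using fspan_zero by (auto simp: bispan_def case_prod_unfold)
  next
    case False
    then have "(\<lambda>(j, t). of_nat j ^ 1 * of_nat t ^ 0) \<in> ?S" by (intro bispan_monomial) auto
    from fspan_scale[OF this[unfolded bispan_def], of u]
    show ?thesis by (simp add: bispan_def case_prod_unfold)
  qed
  have v: "(\<lambda>(j, t). v * of_nat t) \<in> ?S"
  proof (cases "v = 0")
    case True
    then show ?thesis using fspan_zero by (auto simp: bispan_def case_prod_unfold)
  next
    case False
    then have "(\<lambda>(j, t). of_nat j ^ 0 * of_nat t ^ 1) \<in> ?S" by (intro bispan_monomial) auto
    from fspan_scale[OF this[unfolded bispan_def], of v]
    show ?thesis by (simp add: bispan_def case_prod_unfold)
  qed
  have "(\<lambda>(j, t). of_nat j ^ 0 * of_nat t ^ 0) \<in> ?S" by (intro bispan_monomial) auto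
  from fspan_scale[OF this[unfolded bispan_def], of w]
  have w: "(\<lambda>(j, t). w) \<in> ?S" by (simp add: bispan_def case_prod_unfold)
  show ?thesis
    using fspan_add[OF fspan_add[OF u[unfolded bispan_def] v[unfolded bispan_def]] w[unfolded bispan_def]]
    by (simp add: bispan_def case_prod_unfold)
qed

text \<open>The sum is linear in \<open>f\<close>, and a monomial \<open>f\<close> turns it into a
  convolution.\<close>

lemma bispan_convolution_sum:
  assumes "f \<in> bispan A B H"
    and "\<And>y z. y \<le> A \<Longrightarrow> z \<le> B \<Longrightarrow> y + z \<le> H \<Longrightarrow> convolution \<rho> \<sigma> y z \<in> fspan T"
  shows "(\<lambda>n. \<Sum>j<n. f (j, n - j) * (\<rho> ^ j * \<sigma> ^ (n - j))) \<in> fspan T"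
proof (rule fspan_linear_image[OF assms(1)[unfolded bispan_def],
      where L = "\<lambda>f n. \<Sum>j<n. f (j, n - j) * (\<rho> ^ j * \<sigma> ^ (n - j))"])
  fix s :: "nat \<times> nat \<Rightarrow> complex"
  assume "s \<in> (\<lambda>(y, z) (j, t). of_nat j ^ y * of_nat t ^ z) `
     {(y, z). y \<le> A \<and> z \<le> B \<and> y + z \<le> H}"
  then obtain y z where yz: "y \<le> A" "z \<le> B" "y + z \<le> H"
    and s: "s = (\<lambda>(j, t). of_nat j ^ y * of_nat t ^ z)" by auto
  have "(\<lambda>n. \<Sum>j<n. s (j, n - j) * (\<rho> ^ j * \<sigma> ^ (n - j))) = convolution \<rho> \<sigma> y z"
    by (auto simp: s convolution_def nat_monomial_def fun_eq_iff mult_ac intro!: sum.cong)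
  then show "(\<lambda>n. \<Sum>j<n. s (j, n - j) * (\<rho> ^ j * \<sigma> ^ (n - j))) \<in> fspan T"
    using assms(2) yz by simp
qed (auto simp: fun_eq_iff algebra_simps sum.distrib sum_distrib_left)

section \<open>The span of the products\<close>

text \<open>Greedy choice: one index takes as much of \<open>l\<close> as its bound allows and the
  rest is passed on. It distributes a power of \<open>n\<close> over the factors of a
  product.\<close>

lemma split_le_sum:
  fixes H :: "'a \<Rightarrow> nat"
  assumes "finite I" "l \<le> sum H I"
  obtains l' where "\<And>\<nu>. \<nu> \<in> I \<Longrightarrow> l' \<nu> \<le> H \<nu>" "l = sum l' I"
proof -
  have "\<exists>l'. (\<forall>\<nu>\<in>I. l' \<nu> \<le> H \<nu>) \<and> l = sum l' I"
    using assms
  proof (induction I arbitrary: l)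
    case empty
    then show ?case by simp
  next
    case (insert \<nu> I)
    then have "l - H \<nu> \<le> sum H I" by auto
    from insert.IH[OF this] obtain l' where
      l': "\<forall>\<nu>\<in>I. l' \<nu> \<le> H \<nu>" "l - H \<nu> = sum l' I" by blast
    have "sum (l'(\<nu> := min l (H \<nu>))) I = sum l' I"
      using insert(2) by (intro sum.cong) auto
    then show ?case
      using l' insert(1,2) by (intro exI[of _ "l'(\<nu> := min l (H \<nu>))"]) auto
  qed
  then show ?thesis using that by blast
qed

text \<open>Each factor takes a share \<open>l' \<nu>\<close> of the power of \<open>n\<close> and
  becomes an exponential monomial evaluated at \<open>A \<nu> * n\<close>. A factor with
  \<open>A \<nu> = 0\<close> is constant in \<open>n\<close> and can carry no power, hence the bound
  on \<open>l\<close>.\<close>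

lemma nat_monomial_in_span_products:
  fixes z :: "nat \<Rightarrow> complex" and A :: "nat \<Rightarrow> int"
  assumes E: "\<And>\<nu> l. \<nu> \<in> {1..k} \<Longrightarrow> l \<le> h \<nu> \<Longrightarrow>
      exp_monomial (z \<nu>) l \<in> fspan ((\<lambda>i n. F (n + int i)) ` {..<D})"
    and l: "l \<le> (\<Sum>\<nu>=1..k. h \<nu> * (if A \<nu> = 0 then 0 else 1))"
  shows "nat_monomial (\<Prod>\<nu>=1..k. z \<nu> powi A \<nu>) l
    \<in> fspan ((\<lambda>i n. \<Prod>\<nu>=1..k. F (A \<nu> * int n + int (i \<nu>))) ` multi_indices k D)"
proof -
  obtain l' where l': "\<And>\<nu>. \<nu> \<in> {1..k} \<Longrightarrow> l' \<nu> \<le> h \<nu> * (if A \<nu> = 0 then 0 else 1)"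
    and l_eq: "l = (\<Sum>\<nu>=1..k. l' \<nu>)"
    using split_le_sum[OF _ l] by auto
  define g where "g \<nu> n = of_nat n ^ l' \<nu> * (z \<nu> powi A \<nu>) ^ n" for \<nu> n
  have g: "g \<nu> \<in> fspan ((\<lambda>i n. F (A \<nu> * int n + int i)) ` {..<D})" if \<nu>: "\<nu> \<in> {1..k}" for \<nu>
  proof -
    have le: "l' \<nu> \<le> h \<nu>" using l'[OF \<nu>] by (auto split: if_splits)
    \<comment> \<open>If \<open>A \<nu> = 0\<close>, then \<open>l' \<nu> = 0\<close> and the scalar
      is the inverse of \<open>0 ^ 0 = 1\<close>.\<close>
    have "g \<nu> n = inverse (of_int (A \<nu>) ^ l' \<nu>) * exp_monomial (z \<nu>) (l' \<nu>) (A \<nu> * int n)" for n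
      using l'[OF \<nu>]
      by (cases "A \<nu> = 0") (auto simp: g_def exp_monomial_def power_mult_distrib power_int_mult)
    moreover have "(\<lambda>n. exp_monomial (z \<nu>) (l' \<nu>) (A \<nu> * int n))
        \<in> fspan ((\<lambda>i n. F (A \<nu> * int n + int i)) ` {..<D})"
      by (rule fspan_linear_image[OF E[OF \<nu> le], where L = "\<lambda>f n. f (A \<nu> * int n)"])
        (auto intro: fun_space.span_base)
    ultimately show ?thesis
      using fspan_scale[of "\<lambda>n. exp_monomial (z \<nu>) (l' \<nu>) (A \<nu> * int n)"] by presburger
  qed
  have "nat_monomial (\<Prod>\<nu>=1..k. z \<nu> powi A \<nu>) l = (\<lambda>n. \<Prod>\<nu>=1..k. g \<nu> n)"
    by (auto simp: nat_monomial_def g_def l_eq prod.distrib power_sum prod_power_distrib fun_eq_iff)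
  then show ?thesis
    using fspan_prod_PiE[of "{1..k}" "\<lambda>_. {..<D}" g "\<lambda>\<nu> i n. F (A \<nu> * int n + int i)"] g
    by (simp add: multi_indices_def)
qed

definition top_products ::
  "(int \<Rightarrow> complex) \<Rightarrow> nat \<Rightarrow> (nat \<Rightarrow> int) \<Rightarrow> (nat \<Rightarrow> int) \<Rightarrow> nat \<Rightarrow> (nat \<Rightarrow> complex) set" where
  "top_products F k a b D =
     (\<lambda>i n. \<Prod>\<nu>=1..k. F ((a \<nu> + b \<nu>) * int n + int (i \<nu>))) ` multi_indices k D"

definition bottom_products ::
  "(int \<Rightarrow> complex) \<Rightarrow> nat \<Rightarrow> (nat \<Rightarrow> int) \<Rightarrow> nat \<Rightarrow> nat \<Rightarrow> (nat \<Rightarrow> complex) set" where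
  "bottom_products F k a D \<beta> =
     (\<lambda>(l, i) n. of_nat n ^ l * (\<Prod>\<nu>=1..k. F (a \<nu> * int n + int (i \<nu>)))) `
       ({..\<beta>} \<times> multi_indices k D)"

text \<open>In the bound on \<open>\<beta>\<close> the 1 pays for resonance, and the sum pays for
  the exponents of factors with \<open>a \<nu> = 0\<close>, whose powers of \<open>n\<close> the
  bottom products cannot supply.\<close>

lemma exp_monomial_product_sum:
  fixes z :: "nat \<Rightarrow> complex" and a b c :: "nat \<Rightarrow> int"
  assumes nz: "\<And>\<nu>. \<nu> \<in> {1..k} \<Longrightarrow> z \<nu> \<noteq> 0"
    and E: "\<And>\<nu> l. \<nu> \<in> {1..k} \<Longrightarrow> l \<le> h \<nu> \<Longrightarrow>
      exp_monomial (z \<nu>) l \<in> fspan ((\<lambda>i n. F (n + int i)) ` {..<D})"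
    and \<beta>: "1 + (\<Sum>\<nu> | \<nu> \<in> {1..k} \<and> a \<nu> = 0. h \<nu>) \<le> \<beta>"
  shows "(\<lambda>n. \<Sum>j<n. \<Prod>\<nu>=1..k. exp_monomial (z \<nu>) (h \<nu>) (a \<nu> * int n + b \<nu> * int j + c \<nu>))
    \<in> fspan (top_products F k a b D \<union> bottom_products F k a D \<beta>)" (is "?f \<in> fspan ?U")
proof -
  define \<rho> where "\<rho> = (\<Prod>\<nu>=1..k. z \<nu> powi (a \<nu> + b \<nu>))"
  define \<sigma> where "\<sigma> = (\<Prod>\<nu>=1..k. z \<nu> powi a \<nu>)"
  have "\<sigma> \<noteq> 0" using nz by (auto simp: \<sigma>_def)
  let ?A = "\<Sum>\<nu>=1..k. h \<nu> * (if a \<nu> + b \<nu> = 0 then 0 else 1)"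
  let ?B = "\<Sum>\<nu>=1..k. h \<nu> * (if a \<nu> = 0 then 0 else 1)"
  let ?H = "\<Sum>\<nu>=1..k. h \<nu>"
  \<comment> \<open>The polynomial part of the summand, in the variables \<open>j\<close> and
    \<open>t = n - j\<close>.\<close>
  define f where "f = (\<lambda>x. \<Prod>\<nu>=1..k. (case x of (j, t) \<Rightarrow>
    of_int (a \<nu> + b \<nu>) * of_nat j + of_int (a \<nu>) * of_nat t + of_int (c \<nu>)) ^ h \<nu> :: complex)"
  have f: "f \<in> bispan ?A ?B ?H"
    unfolding f_def
  proof (rule bispan_prod)
    fix \<nu>
    show "(\<lambda>x. (case x of (j, t) \<Rightarrow> of_int (a \<nu> + b \<nu>) * of_nat j + of_int (a \<nu>) * of_nat t
        + of_int (c \<nu>)) ^ h \<nu>) \<in> bispan (h \<nu> * (if a \<nu> + b \<nu> = 0 then 0 else 1))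
          (h \<nu> * (if a \<nu> = 0 then 0 else 1)) (h \<nu>)"
      using bispan_power[OF bispan_linear_form[of "of_int (a \<nu> + b \<nu>)" "of_int (a \<nu>)" "of_int (c \<nu>)"],
          of "h \<nu>"]
      by (simp only: of_int_eq_0_iff mult_1_right)
  qed simp
  have top: "nat_monomial \<rho> l \<in> fspan ?U" if "l \<le> ?A" for l
    unfolding \<rho>_def
    by (rule fspan_mono[OF nat_monomial_in_span_products[where F = F and h = h and D = D]])
      (use E that in \<open>auto simp: top_products_def\<close>)
  \<comment> \<open>The power \<open>l\<close> comes from the products of values of
    \<open>F\<close>, the power \<open>l'\<close> from the polynomial coefficient.\<close>
  have bottom: "nat_monomial \<sigma> (l' + l) \<in> fspan ?U" if l: "l \<le> ?B" and l': "l' \<le> \<beta>" for l l'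
  proof -
    have "nat_monomial \<sigma> l
        \<in> fspan ((\<lambda>i n. \<Prod>\<nu>=1..k. F (a \<nu> * int n + int (i \<nu>))) ` multi_indices k D)"
      unfolding \<sigma>_def by (rule nat_monomial_in_span_products[OF E l])
    then have "(\<lambda>n. of_nat n ^ l' * nat_monomial \<sigma> l n) \<in> fspan ?U"
      by (rule fspan_linear_image[where L = "\<lambda>f n. of_nat n ^ l' * f n"])
        (use l' in \<open>force simp: bottom_products_def algebra_simps intro: fun_space.span_base\<close>)+
    moreover have "(\<lambda>n. of_nat n ^ l' * nat_monomial \<sigma> l n) = nat_monomial \<sigma> (l' + l)"
      by (simp add: nat_monomial_def fun_eq_iff power_add)
    ultimately show ?thesis by simp
  qed
  have "(\<lambda>n. \<Sum>j<n. f (j, n - j) * (\<rho> ^ j * \<sigma> ^ (n - j))) \<in> fspan ?U"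
  proof (rule bispan_convolution_sum[OF f])
    fix y t assume yt: "y \<le> ?A" "t \<le> ?B" "y + t \<le> ?H"
    show "convolution \<rho> \<sigma> y t \<in> fspan ?U"
    proof (cases "\<rho> = \<sigma>")
      \<comment> \<open>Both degrees stay within reach of the products, so constant coefficients
        (\<open>l' = 0\<close>) suffice here.\<close>
      case False
      show ?thesis
        by (rule fspan_trans[OF convolution_nonresonant[OF False \<open>\<sigma> \<noteq> 0\<close>]])
          (use yt top bottom[of _ 0] in auto)
    next
      case True
      \<comment> \<open>The total degree exceeds what the bottom products absorb by exactly the
        exponents at indices with \<open>a \<nu> = 0\<close>.\<close>
      have "?H = ?B + (\<Sum>\<nu>=1..k. if a \<nu> = 0 then h \<nu> else 0)"
        by (subst sum.distrib[symmetric]) (auto intro: sum.cong)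
      also have "(\<Sum>\<nu>=1..k. if a \<nu> = 0 then h \<nu> else 0) = (\<Sum>\<nu> | \<nu> \<in> {1..k} \<and> a \<nu> = 0. h \<nu>)"
        by (rule sum.inter_filter[symmetric]) simp
      finally have "Suc (y + t) \<le> ?B + \<beta>" using yt(3) \<beta> by linarith
      have "nat_monomial \<sigma> l \<in> fspan ?U" if "l \<le> Suc (y + t)" for l
      proof -
        \<comment> \<open>The products absorb as much of \<open>l\<close> as they can; the remainder
          goes to the coefficient polynomial.\<close>
        have "min l ?B \<le> ?B" "l - min l ?B \<le> \<beta>" "l - min l ?B + min l ?B = l"
          using that \<open>Suc (y + t) \<le> ?B + \<beta>\<close> by linarith+
        then show ?thesis using bottom[of "min l ?B" "l - min l ?B"] by presburger
      qed
      then show ?thesis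
        unfolding True by (intro fspan_trans[OF convolution_resonant[OF \<open>\<sigma> \<noteq> 0\<close>]]) auto
    qed
  qed
  then have *: "(\<lambda>n. (\<Prod>\<nu>=1..k. z \<nu> powi c \<nu>) * (\<Sum>j<n. f (j, n - j) * (\<rho> ^ j * \<sigma> ^ (n - j))))
      \<in> fspan ?U"
    by (rule fspan_scale)
  have factor: "exp_monomial (z \<nu>) (h \<nu>) (a \<nu> * int n + b \<nu> * int j + c \<nu>) =
      z \<nu> powi c \<nu> * ((of_int (a \<nu> + b \<nu>) * of_nat j + of_int (a \<nu>) * of_nat (n - j)
        + of_int (c \<nu>)) ^ h \<nu> * ((z \<nu> powi (a \<nu> + b \<nu>)) ^ j * (z \<nu> powi a \<nu>) ^ (n - j)))"
    if "j < n" "\<nu> \<in> {1..k}" for j n \<nu>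
  proof -
    \<comment> \<open>Substitution \<open>n = j + (n - j)\<close>, exact on naturals because
      \<open>j < n\<close>.\<close>
    have eq: "a \<nu> * int n + b \<nu> * int j + c \<nu> =
        (a \<nu> + b \<nu>) * int j + a \<nu> * int (n - j) + c \<nu>"
      using that(1) by (simp add: of_nat_diff algebra_simps)
    have "z \<nu> powi ((a \<nu> + b \<nu>) * int j + a \<nu> * int (n - j) + c \<nu>) =
        z \<nu> powi c \<nu> * ((z \<nu> powi (a \<nu> + b \<nu>)) ^ j * (z \<nu> powi a \<nu>) ^ (n - j))"
    proof -
      have "z \<nu> \<noteq> 0" by (rule nz[OF that(2)])
      then show ?thesis
        by (subst power_int_add, simp, subst power_int_add, simp)
          (simp only: power_int_mult power_int_of_nat mult.assoc mult.commute[of "z \<nu> powi c \<nu>"])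
    qed
    then show ?thesis
      unfolding eq exp_monomial_def by (simp only: of_int_add of_int_mult of_int_of_nat_eq mult_ac)
  qed
  have "?f = (\<lambda>n. (\<Prod>\<nu>=1..k. z \<nu> powi c \<nu>) * (\<Sum>j<n. f (j, n - j) * (\<rho> ^ j * \<sigma> ^ (n - j))))"
    unfolding f_def \<rho>_def \<sigma>_def
    by (auto simp: fun_eq_iff factor sum_distrib_left prod.distrib prod_power_distrib intro!: sum.cong)
  with * show ?thesis by simp
qed

lemma closed_form_of_fspan:
  assumes "product_sum F k a b c \<in> fspan (top_products F k a b D \<union> bottom_products F k a D \<beta>)"
  shows "\<exists>\<alpha> \<psi>. is_closed_form F k a b c D \<beta> \<alpha> \<psi>"
proof -
  let ?M = "multi_indices k D"
  have "finite ?M" by (auto simp: multi_indices_def intro: finite_PiE)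
  obtain f g where fg: "product_sum F k a b c = f + g"
    and f: "f \<in> fspan (top_products F k a b D)" and g: "g \<in> fspan (bottom_products F k a D \<beta>)"
    using assms unfolding fun_space.span_Un by blast
  obtain \<alpha> where \<alpha>: "f = (\<lambda>n. \<Sum>i\<in>?M. \<alpha> i * (\<Prod>\<nu>=1..k. F ((a \<nu> + b \<nu>) * int n + int (i \<nu>))))"
    using fspan_imageE[OF f[unfolded top_products_def] \<open>finite ?M\<close>] by blast
  obtain u where u: "g = (\<lambda>n. \<Sum>x\<in>{..\<beta>} \<times> ?M. u x *
      (case x of (l, i) \<Rightarrow> \<lambda>n. of_nat n ^ l * (\<Prod>\<nu>=1..k. F (a \<nu> * int n + int (i \<nu>)))) n)"
    using fspan_imageE[OF g[unfolded bottom_products_def]] \<open>finite ?M\<close> by blast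
  define \<psi> where "\<psi> i = (\<Sum>l\<le>\<beta>. monom (u (l, i)) l)" for i
  have "degree (\<psi> i) \<le> \<beta>" for i
    unfolding \<psi>_def by (rule degree_sum_le) (auto intro: order.trans[OF degree_monom_le])
  moreover have "g n = (\<Sum>i\<in>?M. poly (\<psi> i) (of_nat n) *
      (\<Prod>\<nu>=1..k. F (a \<nu> * int n + int (i \<nu>))))" for n
  proof -
    have "g n = (\<Sum>l\<le>\<beta>. \<Sum>i\<in>?M. u (l, i) *
        (of_nat n ^ l * (\<Prod>\<nu>=1..k. F (a \<nu> * int n + int (i \<nu>)))))"
      by (simp add: u sum.cartesian_product case_prod_unfold)
    then show ?thesis
      by (subst (asm) sum.swap) (simp add: \<psi>_def poly_sum poly_monom sum_distrib_right mult_ac)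
  qed
  ultimately show ?thesis
    by (intro exI[of _ \<alpha>] exI[of _ \<psi>]) (simp add: is_closed_form_def fg \<alpha>)
qed

section \<open>Rational coefficients\<close>

interpretation rat_complex: vector_space "\<lambda>(q::rat) (z::complex). of_rat q * z"
  by unfold_locales (auto simp: algebra_simps of_rat_add of_rat_mult)

interpretation rat_rat: vector_space "\<lambda>(q::rat) (z::rat). q * z"
  by unfold_locales (auto simp: algebra_simps)

interpretation rat_pair: vector_space_pair "\<lambda>(q::rat) (z::complex). of_rat q * z" "\<lambda>(q::rat) (z::rat). q * z"
  ..

text \<open>Since 1 is nonzero, it extends to a basis of the complex numbers over the rationals, so
  some rational-linear functional takes it to 1; its values are embedded back into the complex
  numbers.\<close>

lemma rational_projection:
  obtains \<phi> :: "complex \<Rightarrow> complex"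
  where "\<And>x y. \<phi> (x + y) = \<phi> x + \<phi> y" "\<And>x q. q \<in> \<rat> \<Longrightarrow> \<phi> (x * q) = \<phi> x * q"
    "\<And>q. q \<in> \<rat> \<Longrightarrow> \<phi> q = q" "\<And>x. \<phi> x \<in> \<rat>"
proof -
  have "rat_complex.independent {1}"
    by (rule rat_complex.independent_if_scalars_zero) auto
  from rat_pair.linear_independent_extend[OF this, of "\<lambda>_. 1"] obtain g
    where "Vector_Spaces.linear (\<lambda>(q::rat) (z::complex). of_rat q * z) (*) g" and g1: "g 1 = 1"
    by auto
  then interpret g: Vector_Spaces.linear "\<lambda>(q::rat) (z::complex). of_rat q * z" "(*)" g by simp
  have scale: "of_rat (g (x * q)) = of_rat (g x) * q" if "q \<in> \<rat>" for x q
  proof -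
    obtain q' where "q = of_rat q'" using \<open>q \<in> \<rat>\<close> by (auto elim: Rats_cases)
    then show ?thesis using g.scale[of q' x] by (simp add: of_rat_mult mult.commute)
  qed
  show ?thesis
  proof (rule that[of "\<lambda>x. of_rat (g x)"])
    fix q :: complex assume "q \<in> \<rat>"
    then show "of_rat (g q) = q" using scale[of q 1] g1 by simp
  qed (auto simp: g.add of_rat_add scale)
qed

text \<open>Apply a rational projection to both sides of the identity. The left side, the products
  of values of \<open>F\<close> and the powers of \<open>n\<close> are rational, so only the
  coefficients change, and they become rational.\<close>

lemma rational_closed_form:
  assumes "is_closed_form F k a b c D \<beta> \<alpha> \<psi>" and F: "\<And>n. F n \<in> \<rat>"
  shows "\<exists>\<alpha> \<psi>. is_closed_form F k a b c D \<beta> \<alpha> \<psi> \<and>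
    (\<forall>i\<in>multi_indices k D. \<alpha> i \<in> \<rat> \<and> (\<forall>j. coeff (\<psi> i) j \<in> \<rat>))"
proof -
  obtain \<phi> :: "complex \<Rightarrow> complex"
    where add: "\<And>x y. \<phi> (x + y) = \<phi> x + \<phi> y" and scale: "\<And>x q. q \<in> \<rat> \<Longrightarrow> \<phi> (x * q) = \<phi> x * q"
      and id: "\<And>q. q \<in> \<rat> \<Longrightarrow> \<phi> q = q" and rat: "\<And>x. \<phi> x \<in> \<rat>"
    using rational_projection by blast
  have zero: "\<phi> 0 = 0" using id[of 0] by simp
  have sum: "\<phi> (sum f A) = (\<Sum>i\<in>A. \<phi> (f i))" for f and A :: "'b set"
    by (induction A rule: infinite_finite_induct) (auto simp: zero add)
  have prod: "(\<Prod>\<nu>=1..k. F (g \<nu>)) \<in> \<rat>" for g by (intro Rats_prod F)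
  have "product_sum F k a b c n \<in> \<rat>" for n
    unfolding product_sum_def by (intro Rats_sum prod)
  then have ps: "\<phi> (product_sum F k a b c n) = product_sum F k a b c n" for n
    by (rule id)
  have deg: "degree (map_poly \<phi> q) \<le> degree q" for q
    by (rule degree_le) (auto simp: coeff_map_poly zero coeff_eq_0)
  have poly: "\<phi> (poly q (of_nat n)) = poly (map_poly \<phi> q) (of_nat n)" for q n
  proof -
    have coeff: "coeff (map_poly \<phi> q) i = \<phi> (coeff q i)" for i
      by (simp add: coeff_map_poly zero)
    have "poly (map_poly \<phi> q) (of_nat n) =
        (\<Sum>i\<le>degree (map_poly \<phi> q). \<phi> (coeff q i) * of_nat n ^ i)"
      by (simp only: poly_altdef coeff)
    \<comment> \<open>The projection may kill leading coefficients, so the degree can drop; the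
      extra terms are zero.\<close>
    also have "\<dots> = (\<Sum>i\<le>degree q. \<phi> (coeff q i) * of_nat n ^ i)"
    proof (intro sum.mono_neutral_left ballI)
      fix i assume "i \<in> {..degree q} - {..degree (map_poly \<phi> q)}"
      then show "\<phi> (coeff q i) * of_nat n ^ i = 0"
        using coeff_eq_0[of "map_poly \<phi> q" i] coeff[of i] by simp
    qed (use deg in auto)
    also have "\<dots> = \<phi> (poly q (of_nat n))"
    proof -
      have "of_nat n ^ i \<in> (\<rat> :: complex set)" for i by simp
      then show ?thesis by (simp only: poly_altdef sum scale)
    qed
    finally show ?thesis ..
  qed
  have "is_closed_form F k a b c D \<beta> (\<lambda>i. \<phi> (\<alpha> i)) (\<lambda>i. map_poly \<phi> (\<psi> i))"
    unfolding is_closed_form_def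
  proof (intro conjI ballI allI)
    fix i assume "i \<in> multi_indices k D"
    then show "degree (map_poly \<phi> (\<psi> i)) \<le> \<beta>"
      using assms(1) order.trans[OF deg] by (auto simp: is_closed_form_def)
  next
    fix n
    have "product_sum F k a b c n =
        (\<Sum>i\<in>multi_indices k D. \<alpha> i * (\<Prod>\<nu>=1..k. F ((a \<nu> + b \<nu>) * int n + int (i \<nu>)))) +
        (\<Sum>i\<in>multi_indices k D. poly (\<psi> i) (of_nat n) * (\<Prod>\<nu>=1..k. F (a \<nu> * int n + int (i \<nu>))))"
      using assms(1) by (simp add: is_closed_form_def)
    from arg_cong[OF this, of \<phi>] show "product_sum F k a b c n =
        (\<Sum>i\<in>multi_indices k D. \<phi> (\<alpha> i) * (\<Prod>\<nu>=1..k. F ((a \<nu> + b \<nu>) * int n + int (i \<nu>)))) +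
        (\<Sum>i\<in>multi_indices k D. poly (map_poly \<phi> (\<psi> i)) (of_nat n) *
          (\<Prod>\<nu>=1..k. F (a \<nu> * int n + int (i \<nu>))))"
      by (simp only: ps add sum scale[OF prod] poly)
  qed
  then show ?thesis
    using rat by (intro exI[of _ "\<lambda>i. \<phi> (\<alpha> i)"] exI[of _ "\<lambda>i. map_poly \<phi> (\<psi> i)"])
      (simp add: coeff_map_poly zero)
qed

theorem theorem1:
  fixes F :: "int \<Rightarrow> complex"
    and p :: "complex poly"
    and d D k \<Delta> \<mu> \<beta> :: nat
    and r :: "nat \<Rightarrow> complex"
    and e :: "nat \<Rightarrow> nat"
    and lam :: "nat \<Rightarrow> nat \<Rightarrow> complex"
    and a b c :: "nat \<Rightarrow> int"
  assumes "is_minimal_char_poly F p"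
    and "D = degree p"
    and "inj_on r {1..d}"
    and "{z. poly p z = 0} = r ` {1..d}"
    and "\<And>m. m \<in> {1..d} \<Longrightarrow> r m \<noteq> 0"
    and "\<And>m. m \<in> {1..d} \<Longrightarrow> e m = order (r m) p"
    and "\<And>n. F n = (\<Sum>m=1..d. \<Sum>h<e m. lam m h * of_int n ^ h * r m powi n)"
    and "\<And>m. m \<in> {1..d} \<Longrightarrow> lam m (e m - 1) \<noteq> 0"
    and "k \<ge> 1"
    and "\<And>i. i \<in> {1..k} \<Longrightarrow> a i \<ge> 0"
    and "\<And>i. i \<in> {1..k} \<Longrightarrow> a i + b i \<ge> 0"
    and "\<And>i. i \<in> {1..k} \<Longrightarrow> \<not> (a i = 0 \<and> a i + b i = 0)"
    and "\<Delta> = Max ((\<lambda>m. e m - 1) ` {1..d})"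
    and "\<mu> = card {i \<in> {1..k}. a i = 0}"
    and "\<beta> = 1 + \<Delta> * \<mu>"
  shows "(\<exists>\<alpha> \<psi>. is_closed_form F k a b c D \<beta> \<alpha> \<psi>) \<and>
         ((\<forall>n. F n \<in> \<rat>) \<longrightarrow>
            (\<exists>\<alpha> \<psi>. is_closed_form F k a b c D \<beta> \<alpha> \<psi> \<and>
               (\<forall>i\<in>multi_indices k D. \<alpha> i \<in> \<rat> \<and> (\<forall>j. coeff (\<psi> i) j \<in> \<rat>))))"
proof -
  \<comment> \<open>\<open>I\<close> lists the pairs (root index, exponent) in the formula for
    \<open>F\<close>; an element of \<open>J\<close> chooses one such term for each of the
    \<open>k\<close> factors.\<close>
  define I where "I = (SIGMA m:{1..d}. {..<e m})"
  define J where "J = {1..k} \<rightarrow>\<^sub>E I"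
  have "finite I" by (simp add: I_def)
  let ?U = "top_products F k a b D \<union> bottom_products F k a D \<beta>"
  have F_eq: "F n = (\<Sum>x\<in>I. lam (fst x) (snd x) * exp_monomial (r (fst x)) (snd x) n)" for n
    unfolding assms(7) I_def
    by (subst sum.Sigma) (auto simp: exp_monomial_def mult.assoc case_prod_unfold)
  have summand: "(\<lambda>n. \<Sum>j<n. \<Prod>\<nu>=1..k. exp_monomial (r (fst (g \<nu>))) (snd (g \<nu>))
      (a \<nu> * int n + b \<nu> * int j + c \<nu>)) \<in> fspan ?U" if g: "g \<in> J" for g
  proof (rule exp_monomial_product_sum)
    fix \<nu> assume "\<nu> \<in> {1..k}"
    then have g\<nu>: "fst (g \<nu>) \<in> {1..d}" "snd (g \<nu>) < e (fst (g \<nu>))"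
      using g by (auto simp: J_def I_def PiE_def Pi_def)
    then show "r (fst (g \<nu>)) \<noteq> 0" using assms(5) by blast
    show "exp_monomial (r (fst (g \<nu>))) l \<in> fspan ((\<lambda>i n. F (n + int i)) ` {..<D})"
      if "l \<le> snd (g \<nu>)" for l
      unfolding assms(2)
      by (rule exp_monomial_in_span_shifts[OF assms(1,3-7)]) (use g\<nu> that in auto)
  next
    \<comment> \<open>Every chosen exponent is at most \<open>\<Delta>\<close>, and
      \<open>\<mu>\<close> indices have \<open>a \<nu> = 0\<close>, which gives the bound
      \<open>1 + \<Delta> * \<mu>\<close>.\<close>
    have "(\<Sum>\<nu> | \<nu> \<in> {1..k} \<and> a \<nu> = 0. snd (g \<nu>)) \<le> (\<Sum>\<nu> | \<nu> \<in> {1..k} \<and> a \<nu> = 0. \<Delta>)"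
    proof (rule sum_mono)
      fix \<nu> assume "\<nu> \<in> {\<nu>. \<nu> \<in> {1..k} \<and> a \<nu> = 0}"
      then have g\<nu>: "fst (g \<nu>) \<in> {1..d}" "snd (g \<nu>) < e (fst (g \<nu>))"
        using g by (auto simp: J_def I_def PiE_def Pi_def)
      have "e (fst (g \<nu>)) - 1 \<le> \<Delta>"
        unfolding assms(13) by (rule Max_ge) (use g\<nu> in auto)
      then show "snd (g \<nu>) \<le> \<Delta>" using g\<nu> by linarith
    qed
    then show "1 + (\<Sum>\<nu> | \<nu> \<in> {1..k} \<and> a \<nu> = 0. snd (g \<nu>)) \<le> \<beta>"
      by (simp add: assms(14,15) mult.commute)
  qed
  have "product_sum F k a b c = (\<lambda>n. \<Sum>j<n. \<Prod>\<nu>=1..k. \<Sum>x\<in>I. lam (fst x) (snd x) *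
      exp_monomial (r (fst x)) (snd x) (a \<nu> * int n + b \<nu> * int j + c \<nu>))"
    unfolding product_sum_def F_eq ..
  also have "\<dots> = (\<lambda>n. \<Sum>g\<in>J. (\<Prod>\<nu>=1..k. lam (fst (g \<nu>)) (snd (g \<nu>))) *
      (\<Sum>j<n. \<Prod>\<nu>=1..k. exp_monomial (r (fst (g \<nu>))) (snd (g \<nu>))
        (a \<nu> * int n + b \<nu> * int j + c \<nu>)))"
    using \<open>finite I\<close> unfolding J_def
    by (intro ext, subst prod_sum_PiE) (simp_all add: prod.distrib sum_distrib_left sum.swap[of _ _ "{..<_}"])
  also have "\<dots> \<in> fspan ?U" by (intro fspan_sum fspan_scale summand)
  finally have "\<exists>\<alpha> \<psi>. is_closed_form F k a b c D \<beta> \<alpha> \<psi>" by (rule closed_form_of_fspan)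
  then show ?thesis using rational_closed_form by blast
qed

end
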